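(* Let $M_1,M_2\subset\mathbb{R}^2$ be non-empty subsets whose Hausdorff distance $\mathrm{D_H}(M_1,M_2)$ is finite. Then: (1) $\mathrm{PB}(M_1)=\mathrm{PB}(M_2)$; (2) $\lambda(\mathrm{PE}(M_i))=0$ for both $i=1,2$; (3) $\mathrm{PUB}(M_1)\equiv\mathrm{PUB}(M_2)\pmod\lambda$. If, moreover, both $M_1$ and $M_2$ are discrete, then (4) $\mathrm{DIS}(M_1)\equiv\mathrm{DIS}(M_2)\equiv\mathrm{PB}(M_2)\pmod\omega$; (5) $\mathrm{DEN}(M_1)\equiv\mathrm{DEN}(M_2)\equiv\mathrm{PUB}(M_2)\pmod\lambda$.
   Context: A set $M\subset\mathbb{R}^n$ is called discrete if $M\cap\{\mathbf{x} : \|\mathbf{x}\|\le r\}$ is finite for every $r>0$ (used for $n=1,2$). For non-empty $A,B\subset\mathbb{R}^2$ put $D_0(A,B)=\sup_{b\in B}\mathrm{dist}(A,b)\in[0,\infty]$, where $\mathrm{dist}(A,b)=\inf_{a\in A}\|a-b\|$, and $\mathrm{D_H}(A,B)=\max(D_0(A,B),D_0(B,A))\in[0,\infty]$ (Hausdorff distance). Let $\mathbb{T}=[0,2\pi)$, and for $\alpha\in\mathbb{T}$ define $\Phi_\alpha:\mathbb{R}^2\to\mathbb{R}$ by $\Phi_\alpha(x_1,x_2)=x_1\cos\alpha+x_2\sin\alpha$. For $M\subset\mathbb{R}^2$ put $\mathrm{DEN}(M)=\{\alpha\in\mathbb{T} : \Phi_\alpha(M)\text{ is dense in }\mathbb{R}\}$;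 $\mathrm{DIS}(M)=\{\alpha\in\mathbb{T} : \Phi_\alpha(M)\text{ is a discrete subset of }\mathbb{R}\}$; $\mathrm{PB}(M)=\{\alpha\in\mathbb{T} : \Phi_\alpha^{-1}(J)\cap M\text{ is bounded in }\mathbb{R}^2\text{ for every bounded subset }J\subset\mathbb{R}\}$; $\mathrm{PUB}(M)=\{\alpha\in\mathbb{T} : \Phi_\alpha^{-1}(J)\cap M\text{ is unbounded in }\mathbb{R}^2\text{ for every open non-empty subset }J\subset\mathbb{R}\}$; $\mathrm{PE}(M)=\mathbb{T}\setminus(\mathrm{PB}(M)\cup\mathrm{PUB}(M))$. $\lambda$ denotes Lebesgue measure. For sets $X,Y\subset\mathbb{T}$, $X\equiv Y\pmod\lambda$ means that the symmetric difference $X\triangle Y$ has Lebesgue measure $0$, and $X\equiv Y\pmod\omega$ means that $X\triangle Y$ is at most countable. *)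

theory Defs
  imports "HOL-Analysis.Analysis"
begin

(* Stronger than topological discreteness: such a set is also closed, e.g. {1/n | n > 0} does
   not qualify. *)
definition discrete_set :: "'a::real_normed_vector set \<Rightarrow> bool" where
  "discrete_set M \<longleftrightarrow> (\<forall>r>0. finite (M \<inter> {x. norm x \<le> r}))"

(* Meaningful for non-empty arguments only: infdist b {} is 0 by convention. *)
definition D0 :: "'a::metric_space set \<Rightarrow> 'a set \<Rightarrow> ereal" where
  "D0 A B = (SUP b\<in>B. ereal (infdist b A))"

definition DH :: "'a::metric_space set \<Rightarrow> 'a set \<Rightarrow> ereal" where
  "DH A B = max (D0 A B) (D0 B A)"

definition TT :: "real set" where
  "TT = {0..<2 * pi}"

definition Phi :: "real \<Rightarrow> real ^ 2 \<Rightarrow> real" where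
  "Phi \<alpha> x = x $ 1 * cos \<alpha> + x $ 2 * sin \<alpha>"

definition DEN :: "(real ^ 2) set \<Rightarrow> real set" where
  "DEN M = {\<alpha> \<in> TT. closure (Phi \<alpha> ` M) = UNIV}"

definition DIS :: "(real ^ 2) set \<Rightarrow> real set" where
  "DIS M = {\<alpha> \<in> TT. discrete_set (Phi \<alpha> ` M)}"

definition PB :: "(real ^ 2) set \<Rightarrow> real set" where
  "PB M = {\<alpha> \<in> TT. \<forall>J. bounded J \<longrightarrow> bounded (Phi \<alpha> -` J \<inter> M)}"

definition PUB :: "(real ^ 2) set \<Rightarrow> real set" where
  "PUB M = {\<alpha> \<in> TT. \<forall>J. open J \<and> J \<noteq> {} \<longrightarrow> \<not> bounded (Phi \<alpha> -` J \<inter> M)}"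

definition PE :: "(real ^ 2) set \<Rightarrow> real set" where
  "PE M = TT - (PB M \<union> PUB M)"

(* Measure zero is membership in null_sets lebesgue, which includes measurability; emeasure
   alone would also be 0 on non-measurable sets. *)
definition eq_mod_lambda :: "real set \<Rightarrow> real set \<Rightarrow> bool" where
  "eq_mod_lambda X Y \<longleftrightarrow> sym_diff X Y \<in> null_sets lebesgue"

definition eq_mod_omega :: "real set \<Rightarrow> real set \<Rightarrow> bool" where
  "eq_mod_omega X Y \<longleftrightarrow> countable (sym_diff X Y)"

end

theory Submission
  imports Defs
begin

text \<open>
  Membership in \<open>PB\<close> is stable under bounded perturbations of the set because every projection is
  1-Lipschitz. The exceptional set \<open>PE\<close> is null by a porosity argument: as \<open>\<alpha>\<close> varies, a point of
  large norm \<open>\<rho>\<close> sweeps through any fixed bounded interval while \<open>\<alpha>\<close> moves by \<open>O(1/\<rho>)\<close>, and it stays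
  there for an angle comparable to \<open>1/\<rho>\<close>. So if infinitely many points of \<open>M\<close> project under \<open>\<alpha>\<close> into
  \<open>[-R, R]\<close>, the set of angles for which no far point of \<open>M\<close> projects into \<open>(p, q)\<close> is porous at \<open>\<alpha>\<close>,
  and the points at which a set is itself porous form a null set. For discrete \<open>M\<close>, an angle in
  \<open>DIS - PB\<close> identifies two points of the countable set \<open>M\<close>, and \<open>DEN - PUB\<close> lies in \<open>PE\<close>.
\<close>

section \<open>Null sets from porosity\<close>

lemma negligible_porous_points:
  fixes F :: "'a::euclidean_space set" and k :: real
  assumes "k > 0"
  shows "negligible {x \<in> F. \<forall>r>0. \<exists>y d. 0 < d \<and> d < r \<and> dist x y < d \<and> ball y (k * d) \<inter> F = {}}"
    (is "negligible ?P")
proof -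
  \<comment> \<open>With ratio at most 1 a hole lies inside its concentric ball, so disjoint Vitali balls have
    disjoint holes; these miss the set but fill a fixed fraction of the balls covering it.\<close>
  define c where "c = min k 1"
  have c: "0 < c" "c \<le> 1" "c \<le> k"
    using assms by (auto simp: c_def)
  \<comment> \<open>\<open>F\<close> is arbitrary, so the porous points are enclosed in a Borel set:
    an open ball missing \<open>F\<close> also misses \<open>closure F\<close>, and the radius
    bounds \<open>inverse (real (Suc n))\<close> leave a countable intersection.\<close>
  define S where "S = closure F \<inter>
    (\<Inter>n. \<Union>{ball y d | y d. 0 < d \<and> d < inverse (real (Suc n)) \<and> ball y (c * d) \<inter> closure F = {}})"
  have sub: "?P \<subseteq> S"
  proof
    fix x assume x: "x \<in> ?P"
    have "x \<in> \<Union>{ball y d | y d. 0 < d \<and> d < inverse (real (Suc n)) \<and> ball y (c * d) \<inter> closure F = {}}" for n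
    proof -
      have "0 < inverse (real (Suc n))" by simp
      then obtain y d where yd: "0 < d" "d < inverse (real (Suc n))" "dist x y < d" "ball y (k * d) \<inter> F = {}"
        using x by blast
      have "ball y (c * d) \<subseteq> ball y (k * d)"
        using c yd by (intro subset_ball) simp
      then have "ball y (c * d) \<inter> closure F = {}"
        using yd by (subst open_Int_closure_eq_empty) auto
      with yd show ?thesis
        by (auto simp: dist_commute intro!: exI[of _ "ball y d"])
    qed
    then show "x \<in> S"
      using x closure_subset[of F] by (auto simp: S_def)
  qed
  have "S \<in> sets borel"
    unfolding S_def
    by (intro sets.Int sets.countable_INT'' borel_closed borel_open open_Union) auto
  then have meas: "S \<in> sets lebesgue"
    by (simp add: sets_completionI_sets)
  define B where "B = ennreal ((1 / c) ^ DIM('a))"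
  have scale: "emeasure lebesgue (ball y d) = B * emeasure lebesgue (ball y (c * d))"
    if "d > 0" for y :: 'a and d
    using that c
    by (simp add: emeasure_ball B_def power_mult_distrib power_divide flip: ennreal_mult)
  have bound: "emeasure lebesgue S \<le> B * ennreal e" if "e > 0" for e
  proof -
    obtain U where U: "open U" "S \<subseteq> U" "U - S \<in> lmeasurable" "emeasure lebesgue (U - S) < ennreal e"
      by (rule sets_lebesgue_outer_open[OF meas \<open>e > 0\<close>])
    \<comment> \<open>Since \<open>S\<close> lies in \<open>closure F\<close>, these two conditions
      place the holes in \<open>U - S\<close>, whose measure is below \<open>e\<close>.\<close>
    define K where "K = {(y, d). 0 < d \<and> ball y d \<subseteq> U \<and> ball y (c * d) \<inter> closure F = {}}"
    have "\<exists>i. i \<in> K \<and> x \<in> ball (fst i) (snd i) \<and> snd i < r" if "x \<in> S" "0 < r" for x r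
    proof -
      obtain s where s: "s > 0" "ball x s \<subseteq> U"
        using U \<open>x \<in> S\<close> by (meson openE subsetD)
      have "min r (s / 2) > 0" using s that by simp
      then obtain n where n: "inverse (real (Suc n)) < min r (s / 2)"
        using reals_Archimedean by blast
      obtain y d where yd: "0 < d" "d < inverse (real (Suc n))" "x \<in> ball y d" "ball y (c * d) \<inter> closure F = {}"
        using \<open>x \<in> S\<close> unfolding S_def by blast
      have "ball y d \<subseteq> ball x s"
      proof
        fix z assume "z \<in> ball y d"
        then show "z \<in> ball x s"
          using yd n dist_triangle[of x z y] by (auto simp: dist_commute)
      qed
      then show ?thesis
        using yd n s by (intro exI[of _ "(y, d)"]) (auto simp: K_def)
    qed
    then obtain C where C: "countable C" "C \<subseteq> K"
      "pairwise (\<lambda>i j. disjnt (ball (fst i) (snd i)) (ball (fst j) (snd j))) C"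
      "negligible (S - (\<Union>i\<in>C. ball (fst i) (snd i)))"
      by (rule Vitali_covering_theorem_balls[of S K fst snd])
    let ?b = "\<lambda>i. ball (fst i) (snd i)" and ?h = "\<lambda>i. ball (fst i) (c * snd i)"
    have hb: "?h i \<subseteq> ?b i" if "i \<in> C" for i
      using that C c by (intro subset_ball) (auto simp: K_def mult_left_le_one_le)
    have disj_b: "disjoint_family_on ?b C"
      using C(3) by (auto simp: disjoint_family_on_def pairwise_def disjnt_def)
    have disj_h: "disjoint_family_on ?h C"
      unfolding disjoint_family_on_def
    proof (intro ballI impI)
      fix i j assume "i \<in> C" "j \<in> C" "i \<noteq> j"
      then show "?h i \<inter> ?h j = {}"
        using hb[of i] hb[of j] disj_b unfolding disjoint_family_on_def by blast
    qed
    have "emeasure lebesgue S \<le> emeasure lebesgue ((\<Union>i\<in>C. ?b i) \<union> (S - (\<Union>i\<in>C. ?b i)))"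
      using C meas by (intro emeasure_mono) (auto intro!: sets.countable_UN'')
    also have "\<dots> = emeasure lebesgue (\<Union>i\<in>C. ?b i)"
      using C by (intro emeasure_Un_null_set) (auto simp: negligible_iff_null_sets intro!: sets.countable_UN'')
    also have "\<dots> = (\<integral>\<^sup>+i. emeasure lebesgue (?b i) \<partial>count_space C)"
      using C disj_b by (intro emeasure_UN_countable) auto
    also have "\<dots> = (\<integral>\<^sup>+i. B * emeasure lebesgue (?h i) \<partial>count_space C)"
      using C by (intro nn_integral_cong scale) (auto simp: K_def)
    also have "\<dots> = B * (\<integral>\<^sup>+i. emeasure lebesgue (?h i) \<partial>count_space C)"
      by (rule nn_integral_cmult) auto
    also have "(\<integral>\<^sup>+i. emeasure lebesgue (?h i) \<partial>count_space C) = emeasure lebesgue (\<Union>i\<in>C. ?h i)"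
      using C disj_h by (intro emeasure_UN_countable[symmetric]) auto
    also have "\<dots> \<le> emeasure lebesgue (U - S)"
    proof (rule emeasure_mono)
      show "(\<Union>i\<in>C. ?h i) \<subseteq> U - S"
      proof (intro UN_least)
        fix i assume "i \<in> C"
        then show "?h i \<subseteq> U - S"
          using hb[of i] C(2) unfolding K_def S_def by fastforce
      qed
    qed (use U in auto)
    also have "\<dots> \<le> ennreal e"
      using U by simp
    finally show ?thesis
      by (simp add: mult_left_mono)
  qed
  have "emeasure lebesgue S \<le> 0 + ennreal e" if "e > 0" for e
  proof -
    \<comment> \<open>The factor \<open>c ^ DIM('a)\<close> cancels \<open>B\<close>.\<close>
    have "emeasure lebesgue S \<le> B * ennreal (e * c ^ DIM('a))"
      using that c by (intro bound) simp
    also have "\<dots> = ennreal e"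
      using that c by (simp add: B_def power_divide flip: ennreal_mult)
    finally show ?thesis by simp
  qed
  then have "emeasure lebesgue S = 0"
    using ennreal_le_epsilon[of 0 "emeasure lebesgue S"] by simp
  then have "negligible S"
    using meas by (auto simp: negligible_iff_null_sets)
  then show ?thesis
    using sub negligible_subset by blast
qed

section \<open>Projections as functions of the angle\<close>

text \<open>The projection in the orthogonal direction \<open>\<alpha> + pi / 2\<close> is the derivative of \<open>Phi \<alpha> x\<close> in \<open>\<alpha>\<close>.\<close>

lemma Phi_shift: "Phi (\<alpha> + t) x = Phi \<alpha> x * cos t + Phi (\<alpha> + pi / 2) x * sin t"
  by (simp add: Phi_def cos_add sin_add algebra_simps)

lemma Phi_diff: "Phi \<alpha> (x - y) = Phi \<alpha> x - Phi \<alpha> y"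
  by (simp add: Phi_def algebra_simps)

text \<open>Pythagoras in the orthonormal frame rotated by \<alpha>. It shows that a small
  projection forces a large derivative in the angle.\<close>

lemma Phi_quadrature: "(Phi \<alpha> x)\<^sup>2 + (Phi (\<alpha> + pi / 2) x)\<^sup>2 = (norm x)\<^sup>2"
proof -
  have "(Phi \<alpha> x)\<^sup>2 + (Phi (\<alpha> + pi / 2) x)\<^sup>2 =
    ((x $ 1)\<^sup>2 + (x $ 2)\<^sup>2) * ((cos \<alpha>)\<^sup>2 + (sin \<alpha>)\<^sup>2)"
    unfolding Phi_def cos_add sin_add cos_pi_half sin_pi_half by algebra
  also have "\<dots> = (norm x)\<^sup>2"
    unfolding power2_norm_eq_inner inner_vec_def by (simp add: sum_2 power2_eq_square)
  finally show ?thesis .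
qed

lemma abs_Phi_le_norm: "\<bar>Phi \<alpha> x\<bar> \<le> norm x"
  using Phi_quadrature[of \<alpha> x] zero_le_power2[of "Phi (\<alpha> + pi / 2) x"]
  by (intro abs_le_square_iff[THEN iffD2, of _ "norm x", simplified]) linarith

lemma DERIV_Phi: "((\<lambda>\<alpha>. Phi \<alpha> x) has_real_derivative Phi (\<alpha> + pi / 2) x) (at \<alpha>)"
  unfolding Phi_def by (auto intro!: derivative_eq_intros simp: cos_add sin_add)

lemma Phi_angle_lipschitz: "\<bar>Phi \<alpha> x - Phi \<beta> x\<bar> \<le> norm x * \<bar>\<alpha> - \<beta>\<bar>"
  using field_differentiable_bound[of UNIV "\<lambda>\<alpha>. Phi \<alpha> x" "\<lambda>\<alpha>. Phi (\<alpha> + pi / 2) x" "norm x" \<beta> \<alpha>]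
    DERIV_Phi abs_Phi_le_norm by (simp add: abs_minus_commute)

text \<open>On the unit interval, which lies below \<open>pi / 3\<close>, the cosine is at least
  1/2, so \<open>sin t - t / 2\<close> does not decrease.\<close>

lemma half_le_sin:
  fixes t :: real
  assumes "0 \<le> t" "t \<le> 1"
  shows "t / 2 \<le> sin t"
proof -
  have "sin 0 - 0 / 2 \<le> sin t - t / 2"
  proof (rule DERIV_nonneg_imp_nondecreasing[OF assms(1)])
    fix s assume s: "0 \<le> s" "s \<le> t"
    have "cos (pi / 3) \<le> cos s"
      using s assms pi_gt3 by (intro cos_monotone_0_pi_le) auto
    then show "\<exists>y. ((\<lambda>t. sin t - t / 2) has_real_derivative y) (at s) \<and> 0 \<le> y"
      by (intro exI[of _ "cos s - 1 / 2"]) (auto intro!: derivative_eq_intros simp: cos_60)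
  qed
  then show ?thesis by simp
qed

text \<open>A far point with small projection has an angular derivative comparable to
  \<open>norm x\<close>. Rotating by \<open>t\<close> in the two directions brings the projection to
  opposite sides of \<open>m\<close>, and the intermediate value theorem applies.\<close>

lemma Phi_attains_nearby:
  fixes m R :: real
  assumes "\<bar>Phi \<alpha> x\<bar> \<le> R" "norm x \<ge> 4 * (R + \<bar>m\<bar>)" "norm x > 0"
  obtains \<beta> where "\<bar>\<beta> - \<alpha>\<bar> \<le> 4 * (R + \<bar>m\<bar>) / norm x" "Phi \<beta> x = m"
proof -
  define t where "t = 4 * (R + \<bar>m\<bar>) / norm x"
  let ?a = "Phi \<alpha> x" and ?b = "Phi (\<alpha> + pi / 2) x"
  have t: "0 \<le> t" "t \<le> 1"
    using assms by (auto simp: t_def field_simps)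
  have "4 * \<bar>?a\<bar> \<le> norm x"
    using assms(1,2) by (simp add: distrib_left)
  then have "(4 * \<bar>?a\<bar>)\<^sup>2 \<le> (norm x)\<^sup>2"
    by (intro power_mono) auto
  then have "(norm x / 2)\<^sup>2 \<le> ?b\<^sup>2"
    using Phi_quadrature[of \<alpha> x] unfolding power_mult_distrib power_divide power2_abs
    by simp (use zero_le_power2[of "norm x"] in linarith)
  then have b: "norm x / 2 \<le> \<bar>?b\<bar>"
    using abs_le_square_iff[of "norm x / 2" ?b] by simp
  \<comment> \<open>Source of the factor 4 in \<open>t\<close>: one 2 is lost in
    \<open>norm x / 2 \<le> \<bar>?b\<bar>\<close>, the other in
    \<open>t / 2 \<le> sin t\<close>.\<close>
  have "R + \<bar>m\<bar> = norm x / 2 * (t / 2)"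
    using assms by (simp add: t_def field_simps)
  also have "\<dots> \<le> \<bar>?b\<bar> * sin t"
    using b half_le_sin[OF t] t by (intro mult_mono) auto
  finally have bs: "R + \<bar>m\<bar> \<le> \<bar>?b\<bar> * sin t" .
  have "\<bar>?a * cos t\<bar> \<le> \<bar>?a\<bar>"
    by (simp add: abs_mult mult_left_le)
  then have ac: "\<bar>?a * cos t\<bar> \<le> R"
    using assms by linarith
  have plus: "Phi (\<alpha> + t) x = ?a * cos t + ?b * sin t"
    by (rule Phi_shift)
  have minus: "Phi (\<alpha> - t) x = ?a * cos t - ?b * sin t"
    using Phi_shift[of \<alpha> "-t" x] by simp
  have cont: "continuous_on {\<alpha> - t..\<alpha> + t} (\<lambda>\<beta>. Phi \<beta> x)"
    unfolding Phi_def by (intro continuous_intros)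
  have "\<exists>\<beta>. \<alpha> - t \<le> \<beta> \<and> \<beta> \<le> \<alpha> + t \<and> Phi \<beta> x = m"
  proof (cases "?b \<ge> 0")
    case True
    then have "Phi (\<alpha> - t) x \<le> m" "m \<le> Phi (\<alpha> + t) x"
      using bs ac unfolding plus minus by linarith+
    then show ?thesis
      using IVT'[of "\<lambda>\<beta>. Phi \<beta> x", OF _ _ _ cont] t by auto
  next
    case False
    then have "R + \<bar>m\<bar> \<le> - (?b * sin t)"
      using bs by simp
    then have "Phi (\<alpha> + t) x \<le> m" "m \<le> Phi (\<alpha> - t) x"
      using ac unfolding plus minus by linarith+
    then show ?thesis
      using IVT2'[of "\<lambda>\<beta>. Phi \<beta> x", OF _ _ _ cont] t by auto
  qed
  then show thesis
    using that unfolding t_def by force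
qed

section \<open>Exceptional angles form a null set\<close>

text \<open>The angles are sorted by a radius \<open>n\<close> beyond which no point of
  \<open>M\<close> projects into the open strip. Each angle in question is then a porous point of
  some \<open>F n\<close>, and countably many null sets cover them all.\<close>

lemma negligible_strip_exceptional:
  fixes M :: "(real ^ 2) set" and p q R :: real
  assumes "p < q"
  shows "negligible {\<alpha>. \<not> bounded (Phi \<alpha> -` {-R..R} \<inter> M) \<and> bounded (Phi \<alpha> -` {p<..<q} \<inter> M)}"
    (is "negligible ?E")
proof -
  define m where "m = (p + q) / 2"
  define w where "w = (q - p) / 2"
  define C where "C = 4 * (\<bar>R\<bar> + \<bar>m\<bar>)"
  have w: "w > 0" and C: "C \<ge> 0"
    using assms by (auto simp: w_def C_def)
  define F where "F n = {\<alpha>. \<forall>x\<in>M. real n < norm x \<longrightarrow> Phi \<alpha> x \<notin> {p<..<q}}" for n :: nat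
  \<comment> \<open>The hole around \<beta> has radius \<open>w / norm x\<close>, while \<beta> is
    within \<open>d = (C + 1) / norm x\<close> of \<alpha>; \<open>k\<close> is the quotient. The
    added 1 makes \<open>d\<close> positive and strictly larger than
    \<open>C / norm x\<close>.\<close>
  define k where "k = w / (C + 1)"
  have k: "k > 0"
    using w C by (simp add: k_def)
  define P where "P n = {\<alpha> \<in> F n. \<forall>r>0. \<exists>\<beta> d. 0 < d \<and> d < r \<and> dist \<alpha> \<beta> < d \<and> ball \<beta> (k * d) \<inter> F n = {}}" for n
  have "?E \<subseteq> (\<Union>n. P n)"
  proof
    fix \<alpha> assume "\<alpha> \<in> ?E"
    then have unb: "\<not> bounded (Phi \<alpha> -` {-R..R} \<inter> M)" and bd: "bounded (Phi \<alpha> -` {p<..<q} \<inter> M)"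
      by auto
    obtain n0 where n0: "\<And>x. x \<in> Phi \<alpha> -` {p<..<q} \<inter> M \<Longrightarrow> norm x \<le> n0"
      using bd unfolding bounded_iff by blast
    obtain n where n: "n0 \<le> real n"
      using real_arch_simple by blast
    have "\<alpha> \<in> F n"
      using n0 n by (force simp: F_def)
    moreover have "\<exists>\<beta> d. 0 < d \<and> d < r \<and> dist \<alpha> \<beta> < d \<and> ball \<beta> (k * d) \<inter> F n = {}" if "r > 0" for r
    proof -
      \<comment> \<open>The three summands make \<open>x\<close> relevant to \<open>F n\<close>,
        meet the size condition of \<open>Phi_attains_nearby\<close>, and give
        \<open>d < r\<close>.\<close>
      have "\<not> (\<forall>x \<in> Phi \<alpha> -` {-R..R} \<inter> M. norm x \<le> real n + C + (C + 1) / r)"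
        using unb by (auto simp: bounded_iff)
      then obtain x where x: "x \<in> M" "\<bar>Phi \<alpha> x\<bar> \<le> R" "norm x > real n + C + (C + 1) / r"
        by (auto simp: abs_le_iff not_le)
      have "(C + 1) / r > 0"
        using C that by simp
      then have nx: "norm x > 0" "norm x > real n" "norm x \<ge> C" "norm x > (C + 1) / r"
        using x C by auto
      obtain \<beta> where \<beta>: "\<bar>\<beta> - \<alpha>\<bar> \<le> C / norm x" "Phi \<beta> x = m"
        using Phi_attains_nearby[of \<alpha> x "\<bar>R\<bar>" m] x nx unfolding C_def by auto
      define d where "d = (C + 1) / norm x"
      have "C / norm x < d"
        using nx by (simp add: d_def divide_strict_right_mono)
      then have "dist \<alpha> \<beta> < d"
        using \<beta> by (simp add: dist_real_def abs_minus_commute)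
      moreover have "0 < d" "d < r"
        using nx C that by (auto simp: d_def field_simps)
      moreover have "\<gamma> \<notin> F n" if "\<gamma> \<in> ball \<beta> (k * d)" for \<gamma>
      proof -
        have "k * d = w / norm x"
          using C by (simp add: k_def d_def)
        then have "\<bar>\<gamma> - \<beta>\<bar> < w / norm x"
          using that by (simp add: dist_real_def abs_minus_commute)
        then have "norm x * \<bar>\<gamma> - \<beta>\<bar> < w"
          using nx by (simp add: field_simps)
        then have "\<bar>Phi \<gamma> x - m\<bar> < w"
          using Phi_angle_lipschitz[of \<gamma> x \<beta>] \<beta> by simp
        then have "Phi \<gamma> x \<in> {p<..<q}"
          by (auto simp: m_def w_def abs_less_iff field_simps)
        then show ?thesis
          using x nx by (auto simp: F_def)
      qed
      ultimately show ?thesis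
        by blast
    qed
    ultimately show "\<alpha> \<in> (\<Union>n. P n)"
      by (auto simp: P_def)
  qed
  moreover have "negligible (\<Union>n. P n)"
    unfolding P_def by (intro negligible_countable_Union) (auto intro!: negligible_porous_points k)
  ultimately show ?thesis
    using negligible_subset by blast
qed

text \<open>An exceptional angle has a bounded \<open>J\<close> with unbounded preimage in
  \<open>M\<close> and a non-empty open \<open>V\<close> with bounded preimage. Enlarging
  \<open>J\<close> to an interval with integer ends and shrinking \<open>V\<close> to one with
  rational ends leaves countably many cases.\<close>

lemma negligible_PE: "negligible (PE M)"
proof -
  define E where "E n p q = {\<alpha>. \<not> bounded (Phi \<alpha> -` {- real n..real n} \<inter> M) \<and> bounded (Phi \<alpha> -` {p<..<q} \<inter> M)}"
    for n :: nat and p q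
  let ?I = "(UNIV :: nat set) \<times> {(p :: real, q). p \<in> \<rat> \<and> q \<in> \<rat> \<and> p < q}"
  have "PE M \<subseteq> (\<Union>(n, p, q) \<in> ?I. E n p q)"
  proof
    fix \<alpha> assume \<alpha>: "\<alpha> \<in> PE M"
    then obtain J where J: "bounded J" "\<not> bounded (Phi \<alpha> -` J \<inter> M)"
      by (auto simp: PE_def PB_def)
    obtain a where a: "\<And>x. x \<in> J \<Longrightarrow> \<bar>x\<bar> \<le> a"
      using J by (auto simp: bounded_iff)
    obtain n where n: "a \<le> real n"
      using real_arch_simple by blast
    have "J \<subseteq> {- real n..real n}"
      using a n by (force simp: abs_le_iff)
    then have unb: "\<not> bounded (Phi \<alpha> -` {- real n..real n} \<inter> M)"
      using J bounded_subset[of "Phi \<alpha> -` {- real n..real n} \<inter> M" "Phi \<alpha> -` J \<inter> M"] by blast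
    obtain V where V: "open V" "V \<noteq> {}" "bounded (Phi \<alpha> -` V \<inter> M)"
      using \<alpha> by (auto simp: PE_def PUB_def)
    obtain y e where e: "e > 0" "ball y e \<subseteq> V"
      using V by (meson ex_in_conv openE)
    obtain p where p: "p \<in> \<rat>" "y - e < p" "p < y"
      using Rats_dense_in_real[of "y - e" y] e by auto
    obtain q where q: "q \<in> \<rat>" "y < q" "q < y + e"
      using Rats_dense_in_real[of y "y + e"] e by auto
    have "{p<..<q} \<subseteq> V"
      using p q e by (auto simp: dist_real_def subset_iff abs_less_iff)
    then have "bounded (Phi \<alpha> -` {p<..<q} \<inter> M)"
      using V bounded_subset[of "Phi \<alpha> -` V \<inter> M" "Phi \<alpha> -` {p<..<q} \<inter> M"] by blast
    then show "\<alpha> \<in> (\<Union>(n, p, q) \<in> ?I. E n p q)"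
      using unb p q by (intro UN_I[of "(n, p, q)"]) (auto simp: E_def)
  qed
  moreover have "negligible (\<Union>(n, p, q) \<in> ?I. E n p q)"
  proof (rule negligible_countable_Union)
    have "?I \<subseteq> UNIV \<times> \<rat> \<times> \<rat>" by auto
    then have "countable ?I"
      by (rule countable_subset) (auto intro!: countable_SIGMA countable_rat)
    then show "countable ((\<lambda>(n, p, q). E n p q) ` ?I)"
      by (rule countable_image)
  qed (auto simp: E_def intro!: negligible_strip_exceptional)
  ultimately show ?thesis
    using negligible_subset by blast
qed

section \<open>Finite Hausdorff distance and \<open>PB\<close>\<close>

lemma D0_finite_nearby:
  fixes A B :: "'a::metric_space set"
  assumes "D0 A B < \<infinity>" "A \<noteq> {}"
  obtains d where "\<And>b. b \<in> B \<Longrightarrow> \<exists>a\<in>A. dist b a < d"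
proof -
  obtain c where c: "D0 A B \<le> ereal c"
    using assms(1) by (cases "D0 A B") auto
  \<comment> \<open>The infimum defining the distance need not be attained, hence the slack
    1.\<close>
  have "\<exists>a\<in>A. dist b a < c + 1" if "b \<in> B" for b
  proof -
    have "ereal (infdist b A) \<le> ereal c"
      using c that unfolding D0_def by (meson SUP_le_iff)
    then have "(INF a\<in>A. dist b a) < c + 1"
      using assms(2) by (simp add: infdist_notempty)
    then show ?thesis
      using assms(2) by (subst (asm) cINF_less_iff) auto
  qed
  then show thesis using that by blast
qed

text \<open>Moving a point by less than \<open>d\<close> moves its projection by less than
  \<open>d\<close>, so a strip of \<open>M2\<close> is controlled by the strip of \<open>M1\<close>
  widened by \<open>d\<close> on both sides.\<close>

lemma PB_subset_of_nearby:
  assumes near: "\<And>x. x \<in> M2 \<Longrightarrow> \<exists>y\<in>M1. dist x y < d"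
  shows "PB M1 \<subseteq> PB M2"
proof
  fix \<alpha> assume \<alpha>: "\<alpha> \<in> PB M1"
  have "bounded (Phi \<alpha> -` J \<inter> M2)" if "bounded J" for J
  proof -
    obtain a where a: "\<And>s. s \<in> J \<Longrightarrow> \<bar>s\<bar> \<le> a"
      using \<open>bounded J\<close> by (auto simp: bounded_iff)
    have "bounded (Phi \<alpha> -` {-(a + d)..a + d} \<inter> M1)"
      using \<alpha> by (auto simp: PB_def)
    then obtain b where "\<forall>y \<in> Phi \<alpha> -` {-(a + d)..a + d} \<inter> M1. norm y \<le> b"
      unfolding bounded_iff by blast
    then have b: "norm y \<le> b" if "y \<in> M1" "\<bar>Phi \<alpha> y\<bar> \<le> a + d" for y
      using that by (auto simp: abs_le_iff)
    have "norm x \<le> b + d" if x: "x \<in> Phi \<alpha> -` J \<inter> M2" for x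
    proof -
      obtain y where y: "y \<in> M1" "norm (x - y) < d"
        using near x by (auto simp: dist_norm)
      have "\<bar>Phi \<alpha> x - Phi \<alpha> y\<bar> < d"
        using abs_Phi_le_norm[of \<alpha> "x - y"] y by (simp add: Phi_diff)
      then have "norm y \<le> b"
        using a[of "Phi \<alpha> x"] x y by (intro b) auto
      then show ?thesis
        using norm_triangle_sub[of x y] y by linarith
    qed
    then show ?thesis
      by (auto simp: bounded_iff)
  qed
  then show "\<alpha> \<in> PB M2"
    using \<alpha> by (auto simp: PB_def)
qed

lemma PB_disjoint_PUB: "PB M \<inter> PUB M = {}"
proof -
  have "open {0<..<1::real}" "{0<..<1::real} \<noteq> {}" "bounded {0<..<1::real}"
    by auto
  then show ?thesis
    unfolding PB_def PUB_def by blast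
qed

section \<open>Projections of discrete sets\<close>

lemma discrete_set_finite_bounded:
  assumes "discrete_set M" "bounded B"
  shows "finite (B \<inter> M)"
proof -
  obtain b where "b > 0" "\<And>x. x \<in> B \<Longrightarrow> norm x \<le> b"
    using assms(2) by (auto simp: bounded_pos)
  then have "B \<inter> M \<subseteq> M \<inter> {x. norm x \<le> b}" and "finite (M \<inter> {x. norm x \<le> b})"
    using assms(1) by (auto simp: discrete_set_def)
  then show ?thesis
    by (rule finite_subset)
qed

lemma discrete_set_countable:
  assumes "discrete_set M"
  shows "countable M"
proof -
  have "M \<subseteq> (\<Union>n. cball 0 (real n) \<inter> M)"
    using real_arch_simple by auto
  moreover have "countable (\<Union>n. cball 0 (real n) \<inter> M)"
    using assms by (intro countable_UN) (auto intro!: countable_finite discrete_set_finite_bounded)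
  ultimately show ?thesis
    using countable_subset by blast
qed

text \<open>The part of \<open>M\<close> over a bounded set is bounded, hence finite, and so is its
  image.\<close>

lemma PB_subset_DIS:
  assumes "discrete_set M"
  shows "PB M \<subseteq> DIS M"
proof
  fix \<alpha> assume \<alpha>: "\<alpha> \<in> PB M"
  have "finite (Phi \<alpha> ` M \<inter> {x. norm x \<le> r})" for r
  proof -
    have "bounded (Phi \<alpha> -` cball 0 r \<inter> M)"
      using \<alpha> by (auto simp: PB_def)
    then have "finite (Phi \<alpha> -` cball 0 r \<inter> M \<inter> M)"
      by (rule discrete_set_finite_bounded[OF assms])
    then have "finite (Phi \<alpha> ` (Phi \<alpha> -` cball 0 r \<inter> M \<inter> M))"
      by (rule finite_imageI)
    then show ?thesis
      by (rule rev_finite_subset) auto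
  qed
  then show "\<alpha> \<in> DIS M"
    using \<alpha> by (auto simp: DIS_def PB_def discrete_set_def)
qed

text \<open>In polar coordinates \<open>Phi \<alpha> x\<close> is
  \<open>r * cos (\<alpha> - \<theta>)\<close>, whose zeros lie among the multiples of
  \<open>pi / 2\<close> shifted by \<theta>.\<close>

lemma countable_Phi_eq_0:
  assumes "x \<noteq> 0"
  shows "countable {\<alpha>. Phi \<alpha> x = 0}"
proof -
  obtain r \<theta> where x: "x $ 1 = r * cos \<theta>" "x $ 2 = r * sin \<theta>"
    using polar_Ex by blast
  have "r \<noteq> 0"
    using assms x by (auto simp: vec_eq_iff forall_2)
  have "{\<alpha>. Phi \<alpha> x = 0} \<subseteq> range (\<lambda>i::int. \<theta> + of_int i * (pi / 2))"
  proof
    fix \<alpha> assume "\<alpha> \<in> {\<alpha>. Phi \<alpha> x = 0}"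
    then have "r * cos (\<alpha> - \<theta>) = 0"
      by (simp add: Phi_def x cos_diff algebra_simps)
    then obtain i :: int where "\<alpha> - \<theta> = of_int i * (pi / 2)"
      using \<open>r \<noteq> 0\<close> by (auto simp: cos_zero_iff_int)
    then have "\<alpha> = \<theta> + of_int i * (pi / 2)"
      by simp
    then show "\<alpha> \<in> range (\<lambda>i::int. \<theta> + of_int i * (pi / 2))"
      by blast
  qed
  then show ?thesis
    by (rule countable_subset) auto
qed

text \<open>Pigeonhole: infinitely many points over a bounded set share finitely many projections,
  so two of them collide. Each of the countably many pairs accounts for countably many
  angles.\<close>

lemma countable_DIS_minus_PB:
  assumes "discrete_set M"
  shows "countable (DIS M - PB M)"
proof -
  let ?I = "{(x, y). x \<in> M \<and> y \<in> M \<and> x \<noteq> y}"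
  have "DIS M - PB M \<subseteq> (\<Union>(x, y)\<in>?I. {\<alpha>. Phi \<alpha> (x - y) = 0})"
  proof
    fix \<alpha> assume \<alpha>: "\<alpha> \<in> DIS M - PB M"
    then obtain J where J: "bounded J" "\<not> bounded (Phi \<alpha> -` J \<inter> M)"
      by (auto simp: DIS_def PB_def)
    have "finite (J \<inter> Phi \<alpha> ` M)"
      using \<alpha> J by (intro discrete_set_finite_bounded) (auto simp: DIS_def)
    then have "finite (Phi \<alpha> ` (Phi \<alpha> -` J \<inter> M))"
      by (rule rev_finite_subset) auto
    moreover have "infinite (Phi \<alpha> -` J \<inter> M)"
      using J finite_imp_bounded by blast
    ultimately have "\<not> inj_on (Phi \<alpha>) (Phi \<alpha> -` J \<inter> M)"
      using finite_imageD by blast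
    then show "\<alpha> \<in> (\<Union>(x, y)\<in>?I. {\<alpha>. Phi \<alpha> (x - y) = 0})"
      by (force simp: inj_on_def Phi_diff)
  qed
  moreover have "countable (\<Union>(x, y)\<in>?I. {\<alpha>. Phi \<alpha> (x - y) = 0})"
  proof (rule countable_UN)
    have "?I \<subseteq> M \<times> M" by auto
    then show "countable ?I"
      by (rule countable_subset) (auto intro: discrete_set_countable assms)
  qed (auto intro!: countable_Phi_eq_0)
  ultimately show ?thesis
    using countable_subset by blast
qed

lemma PUB_subset_DEN: "PUB M \<subseteq> DEN M"
proof
  fix \<alpha> assume \<alpha>: "\<alpha> \<in> PUB M"
  have "V \<inter> Phi \<alpha> ` M \<noteq> {}" if V: "open V" "V \<noteq> {}" for V
  proof -
    have "Phi \<alpha> -` V \<inter> M \<noteq> {}"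
      using \<alpha> V by (force simp: PUB_def)
    then show ?thesis by auto
  qed
  \<comment> \<open>If non-empty, the complement of the closure would be an open set missed by the
    projection.\<close>
  from this[of "- closure (Phi \<alpha> ` M)"] have "closure (Phi \<alpha> ` M) = UNIV"
    using closure_subset[of "Phi \<alpha> ` M"] by blast
  then show "\<alpha> \<in> DEN M"
    using \<alpha> by (auto simp: DEN_def PUB_def)
qed

text \<open>By \<open>PB_subset_DIS\<close> a common angle would give a projection both dense and
  discrete, so finitely many points would be dense in the unit interval.\<close>

lemma DEN_disjoint_PB:
  assumes "discrete_set M"
  shows "DEN M \<inter> PB M = {}"
proof -
  have False if \<alpha>: "\<alpha> \<in> DEN M" "\<alpha> \<in> PB M" for \<alpha>
  proof -
    have "discrete_set (Phi \<alpha> ` M)"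
      using \<alpha> PB_subset_DIS[OF assms] by (auto simp: DIS_def)
    then have "finite ({0<..<1} \<inter> Phi \<alpha> ` M)"
      by (rule discrete_set_finite_bounded) auto
    moreover have "{0<..<1} \<subseteq> closure ({0<..<1} \<inter> Phi \<alpha> ` M)"
      using \<alpha> open_Int_closure_subset[of "{0<..<1::real}" "Phi \<alpha> ` M"] by (auto simp: DEN_def)
    ultimately have "finite {0<..<1::real}"
      by (metis closure_closed finite_imp_closed finite_subset)
    then show False
      by (simp add: infinite_Ioo)
  qed
  then show ?thesis by blast
qed

section \<open>Comparison of the two sets\<close>

lemma eq_mod_lambda_subsetI:
  assumes "sym_diff X Y \<subseteq> N" "negligible N"
  shows "eq_mod_lambda X Y"
  using assms negligible_subset unfolding eq_mod_lambda_def negligible_iff_null_sets[symmetric] by blast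

theorem theorem6p2:
  fixes M1 M2 :: "(real ^ 2) set"
  assumes "M1 \<noteq> {}" and "M2 \<noteq> {}" and "DH M1 M2 < \<infinity>"
  shows "PB M1 = PB M2 \<and>
    (PE M1 \<in> null_sets lebesgue \<and> PE M2 \<in> null_sets lebesgue) \<and>
    eq_mod_lambda (PUB M1) (PUB M2) \<and>
    (discrete_set M1 \<and> discrete_set M2 \<longrightarrow>
      (eq_mod_omega (DIS M1) (DIS M2) \<and> eq_mod_omega (DIS M2) (PB M2)) \<and>
      (eq_mod_lambda (DEN M1) (DEN M2) \<and> eq_mod_lambda (DEN M2) (PUB M2)))"
proof -
  have "D0 M1 M2 < \<infinity>" "D0 M2 M1 < \<infinity>"
    using assms(3) by (auto simp: DH_def)
  then obtain d e where "\<And>b. b \<in> M2 \<Longrightarrow> \<exists>a\<in>M1. dist b a < d" "\<And>b. b \<in> M1 \<Longrightarrow> \<exists>a\<in>M2. dist b a < e"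
    using D0_finite_nearby assms(1,2) by metis
  then have PB: "PB M1 = PB M2"
    by (intro antisym PB_subset_of_nearby) blast+
  have neg: "negligible (PE M1)" "negligible (PE M2)" "negligible (PE M1 \<union> PE M2)"
    by (auto intro: negligible_PE)
  \<comment> \<open>Up to the null set \<open>PE M\<close>, \<open>PUB M\<close> is the complement
    of \<open>PB M\<close>, which \<open>M1\<close> and \<open>M2\<close> share.\<close>
  have PUB: "PUB M = TT - PB M - PE M" for M
    using PB_disjoint_PUB[of M] by (auto simp: PE_def PUB_def)
  have "eq_mod_lambda (PUB M1) (PUB M2)"
    using PB PUB by (intro eq_mod_lambda_subsetI[OF _ neg(3)]) blast
  moreover have "eq_mod_omega (DIS M1) (DIS M2) \<and> eq_mod_omega (DIS M2) (PB M2)"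
    if discr: "discrete_set M1" "discrete_set M2"
  proof -
    have "countable ((DIS M1 - PB M1) \<union> (DIS M2 - PB M2))"
      using discr by (auto intro: countable_DIS_minus_PB)
    \<comment> \<open>Each \<open>DIS\<close> contains the common \<open>PB\<close> and exceeds it
      by a countable set only.\<close>
    moreover have "sym_diff (DIS M1) (DIS M2) \<subseteq> (DIS M1 - PB M1) \<union> (DIS M2 - PB M2)"
      and "sym_diff (DIS M2) (PB M2) \<subseteq> (DIS M1 - PB M1) \<union> (DIS M2 - PB M2)"
      using PB discr[THEN PB_subset_DIS] by blast+
    ultimately show ?thesis
      unfolding eq_mod_omega_def by (blast intro: countable_subset)
  qed
  moreover have "eq_mod_lambda (DEN M1) (DEN M2) \<and> eq_mod_lambda (DEN M2) (PUB M2)"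
    if discr: "discrete_set M1" "discrete_set M2"
  proof -
    have "DEN M - PUB M \<subseteq> PE M" if "discrete_set M" for M
      using DEN_disjoint_PB[OF that] by (auto simp: PE_def DEN_def)
    from this[OF discr(1)] this[OF discr(2)] have "sym_diff (DEN M1) (DEN M2) \<subseteq> PE M1 \<union> PE M2" "sym_diff (DEN M2) (PUB M2) \<subseteq> PE M1 \<union> PE M2"
      using PB PUB[of M1] PUB[of M2] PUB_subset_DEN[of M1] PUB_subset_DEN[of M2] by blast+
    then show ?thesis
      using eq_mod_lambda_subsetI neg(3) by blast
  qed
  ultimately show ?thesis
    using PB neg by (simp add: negligible_iff_null_sets)
qed

end
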